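(* Let $k\ge 2$. (1) The spectrum (as a multiset) of a $k$-uniform hypergraph $H$ is independent of the ordering of its vertices; that is, the adjacency tensors of $H$ with respect to any two orderings of its vertices have the same spectrum as multisets. (2) Isomorphic $k$-uniform hypergraphs have the same spectra (as multisets).
   Context: A $k$-uniform hypergraph $H=(V,E)$ has finite vertex set $V$ and edge set $E$ consisting of $k$-element subsets of $V$. Given an ordering of the $n$ vertices, identifying $V$ with $[n]=\{1,\dots,n\}$, its adjacency tensor is the order $k$ dimension $n$ tensor $\mathbb{A}_H=(a_{i_1\cdots i_k})$ with $a_{i_1\cdots i_k}=\frac{1}{(k-1)!}$ if $\{i_1,\dots,i_k\}\in E$ (as a $k$-element set) and $0$ otherwise. The spectrum of $H$ is the spectrum of its adjacency tensor. For an order $k$ dimension $n$ complex tensor $\mathbb{A}$ and $x\in\mathbb{C}^n$, $\mathbb{A}x\in\mathbb{C}^n$ is given by $(\mathbb{A}x)_i=\sum_{i_2,\dots,i_k=1}^n a_{ii_2\cdots i_k}x_{i_2}\cdots x_{i_k}$. The unit tensor $\mathbb{I}$ has entry $1$ if all its indices are equal and $0$ otherwise. The hyperdeterminant $\det(\mathbb{A})$ is the resultant of the system $\mathbb{A}x=0$ of $n$ homogeneous equations of degree $k-1$, i.e. the unique polynomial in the entries of $\mathbb{A}$ (viewed as independent variables) that vanishes iff $\mathbb{A}x=0$ has a nonzero solution in $\mathbb{C}^n$, equals $1$ at $\mathbb{I}$, and is irreducible. The characteristic polynomial is $\phi_{\mathbb{A}}(\lambda)=\det(\lambda\mathbb{I}-\mathbb{A})$,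 and the spectrum of $\mathbb{A}$ (as a multiset) is the multiset of roots of $\phi_{\mathbb{A}}$. *)

theory Defs
  imports
    Complex_Main
    "HOL-Library.Poly_Mapping"
    "HOL-Computational_Algebra.Polynomial"
begin

section \<open>Multivariate polynomials\<close>

text \<open>
  Polynomials over \<open>'c\<close> in variables \<open>'v\<close>, as finitely supported functions from monomials to
  coefficients; a monomial is a finitely supported exponent function. The ring structure is the
  convolution product from \<^theory>\<open>HOL-Library.Poly_Mapping\<close>.
\<close>

type_synonym ('v, 'c) mpolynomial = "('v \<Rightarrow>\<^sub>0 nat) \<Rightarrow>\<^sub>0 'c"

definition mpoly_vars :: "('v, 'c::zero) mpolynomial \<Rightarrow> 'v set" where
  "mpoly_vars P = (\<Union>m\<in>Poly_Mapping.keys P. Poly_Mapping.keys m)"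

text \<open>
  Evaluation at \<open>x\<close> in a ring \<open>'b\<close> into which the coefficients are mapped by \<open>h\<close>.
\<close>

definition mpoly_eval ::
  "('c::zero \<Rightarrow> 'b::comm_ring_1) \<Rightarrow> ('v \<Rightarrow> 'b) \<Rightarrow> ('v, 'c) mpolynomial \<Rightarrow> 'b" where
  "mpoly_eval h x P =
     (\<Sum>m\<in>Poly_Mapping.keys P.
        h (Poly_Mapping.lookup P m) * (\<Prod>v\<in>Poly_Mapping.keys m. x v ^ Poly_Mapping.lookup m v))"


section \<open>Tensors, hyperdeterminant and spectrum\<close>

text \<open>
  A tensor of order \<open>k\<close> and dimension \<open>n\<close> is a function on index lists of which only the values
  on \<open>tensor_indices k n\<close> are relevant. Likewise a vector of dimension \<open>n\<close> is a function on
  \<open>nat\<close> of which only the values on \<open>{1..n}\<close> are relevant.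
\<close>

type_synonym 'a tensor = "nat list \<Rightarrow> 'a"

definition tensor_indices :: "nat \<Rightarrow> nat \<Rightarrow> nat list set" where
  "tensor_indices k n = {is. set is \<subseteq> {1..n} \<and> length is = k}"

definition tensor_apply ::
  "nat \<Rightarrow> nat \<Rightarrow> complex tensor \<Rightarrow> (nat \<Rightarrow> complex) \<Rightarrow> nat \<Rightarrow> complex" where
  "tensor_apply k n A x i = (\<Sum>js\<in>tensor_indices (k - 1) n. A (i # js) * prod_list (map x js))"

definition unit_tensor :: "'a::zero_neq_one tensor" where
  "unit_tensor is = (if \<forall>i\<in>set is. \<forall>j\<in>set is. i = j then 1 else 0)"

text \<open>
  \<open>D\<close> is a hyperdeterminant polynomial, with one variable for each tensor entry. All variables of
  \<open>D\<close> belong to \<open>tensor_indices k n\<close>, and factors and units of such a polynomial involve no other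
  variables, so irreducibility in the polynomial ring over all index lists is irreducibility in
  the polynomial ring over the entries of the tensor.
\<close>

definition is_hyperdet_poly :: "nat \<Rightarrow> nat \<Rightarrow> (nat list, complex) mpolynomial \<Rightarrow> bool" where
  "is_hyperdet_poly k n D \<longleftrightarrow>
     mpoly_vars D \<subseteq> tensor_indices k n \<and>
     irreducible D \<and>
     mpoly_eval id unit_tensor D = 1 \<and>
     (\<forall>A :: complex tensor. mpoly_eval id A D = 0 \<longleftrightarrow>
        (\<exists>x. (\<exists>i\<in>{1..n}. x i \<noteq> 0) \<and> (\<forall>i\<in>{1..n}. tensor_apply k n A x i = 0)))"

text \<open>
  By the classical theory of resultants there is exactly one such polynomial whenever \<open>k \<ge> 2\<close> and
  \<open>n \<ge> 1\<close>. The value 0 only makes the function total: it covers degenerate parameters such as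
  \<open>n = 0\<close>, where the characteristic polynomial below becomes 0 and the spectrum is empty.
\<close>

definition hyperdet_poly :: "nat \<Rightarrow> nat \<Rightarrow> (nat list, complex) mpolynomial" where
  "hyperdet_poly k n =
     (if \<exists>!D. is_hyperdet_poly k n D then (THE D. is_hyperdet_poly k n D) else 0)"

definition hyperdet :: "nat \<Rightarrow> nat \<Rightarrow> complex tensor \<Rightarrow> complex" where
  "hyperdet k n A = mpoly_eval id A (hyperdet_poly k n)"

text \<open>
  The characteristic polynomial is the hyperdeterminant of \<open>\<lambda>I - A\<close>, with entries taken in the
  polynomial ring in \<open>\<lambda>\<close>.
\<close>

definition tensor_charpoly :: "nat \<Rightarrow> nat \<Rightarrow> complex tensor \<Rightarrow> complex poly" where
  "tensor_charpoly k n A =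
     mpoly_eval (\<lambda>c. [:c:]) (\<lambda>is. [:0, 1:] * unit_tensor is - [:A is:]) (hyperdet_poly k n)"

lemma poly_tensor_charpoly:
  "poly (tensor_charpoly k n A) z = hyperdet k n (\<lambda>is. z * unit_tensor is - A is)"
proof -
  have "poly (unit_tensor is) z = unit_tensor is" for "is"
    by (simp add: unit_tensor_def)
  then show ?thesis
    by (simp add: tensor_charpoly_def hyperdet_def mpoly_eval_def poly_sum poly_prod)
qed

definition tensor_spectrum :: "nat \<Rightarrow> nat \<Rightarrow> complex tensor \<Rightarrow> complex multiset" where
  "tensor_spectrum k n A = proots (tensor_charpoly k n A)"


section \<open>Uniform hypergraphs\<close>

definition uniform_hypergraph :: "nat \<Rightarrow> 'a set \<Rightarrow> 'a set set \<Rightarrow> bool" where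
  "uniform_hypergraph k V E \<longleftrightarrow> finite V \<and> (\<forall>e\<in>E. e \<subseteq> V \<and> card e = k)"

text \<open>
  An ordering lists the vertices: \<open>f i\<close> is the \<open>i\<close>-th vertex.
\<close>

definition vertex_ordering :: "'a set \<Rightarrow> (nat \<Rightarrow> 'a) \<Rightarrow> bool" where
  "vertex_ordering V f \<longleftrightarrow> bij_betw f {1..card V} V"

text \<open>
  Edges have \<open>k\<close> elements, so for \<open>is\<close> of length \<open>k\<close> the condition \<open>f ` set is \<in> E\<close> forces the
  indices in \<open>is\<close> to be distinct.
\<close>

definition adjacency_tensor :: "nat \<Rightarrow> 'a set set \<Rightarrow> (nat \<Rightarrow> 'a) \<Rightarrow> complex tensor" where
  "adjacency_tensor k E f is = (if f ` set is \<in> E then 1 / fact (k - 1) else 0)"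

definition hypergraph_spectrum ::
  "nat \<Rightarrow> 'a set \<Rightarrow> 'a set set \<Rightarrow> (nat \<Rightarrow> 'a) \<Rightarrow> complex multiset" where
  "hypergraph_spectrum k V E f = tensor_spectrum k (card V) (adjacency_tensor k E f)"

definition hypergraph_isomorphic ::
  "'a set \<Rightarrow> 'a set set \<Rightarrow> 'b set \<Rightarrow> 'b set set \<Rightarrow> bool" where
  "hypergraph_isomorphic V E W F \<longleftrightarrow>
     (\<exists>\<phi>. bij_betw \<phi> V W \<and> (\<forall>e. e \<subseteq> V \<longrightarrow> (e \<in> E \<longleftrightarrow> \<phi> ` e \<in> F)))"

end

theory Submission
  imports Defs "HOL-Combinatorics.Permutations"
begin

text \<open>
  Reordering the vertices permutes the indices of the adjacency tensor, and the defining
  properties of the hyperdeterminant polynomial are invariant under the corresponding renaming of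
  variables. As \<^const>\<open>hyperdet_poly\<close> is the only polynomial with these properties (or else 0),
  it is fixed by the renaming. The unit tensor is fixed as well, and hence so is the
  characteristic polynomial.
\<close>

section \<open>Multiplicative bijections and the convolution product\<close>

text \<open>Irreducibility refers only to products, units and 0, all of which \<open>T\<close>
  preserves and reflects.\<close>

lemma irreducible_bij_image:
  fixes T :: "'a::comm_semiring_1 \<Rightarrow> 'b::comm_semiring_1"
  assumes "bij T" and "T 0 = 0" and "T 1 = 1" and mult: "\<And>a b. T (a * b) = T a * T b"
    and "irreducible p"
  shows "irreducible (T p)"
proof -
  have T_eq: "T a = T b \<longleftrightarrow> a = b" for a b
    using \<open>bij T\<close> by (simp add: bij_is_inj inj_eq)
  have surj: "\<exists>a. b = T a" for b
    using \<open>bij T\<close> by (meson bij_pointE)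
  have unit: "T a dvd 1 \<longleftrightarrow> a dvd 1" for a
  proof
    assume "T a dvd 1"
    then obtain b where "1 = T a * T b"
      using surj by (metis dvdE)
    then have "T (a * b) = T 1"
      by (simp add: mult \<open>T 1 = 1\<close>)
    then show "a dvd 1"
      by (metis T_eq dvdI)
  next
    assume "a dvd 1"
    then show "T a dvd 1"
      by (metis \<open>T 1 = 1\<close> dvd_def mult)
  qed
  show ?thesis
  proof (rule irreducibleI)
    show "T p \<noteq> 0"
      using \<open>irreducible p\<close> \<open>T 0 = 0\<close> T_eq by (metis not_irreducible_zero)
    show "\<not> T p dvd 1"
      using \<open>irreducible p\<close> by (simp add: unit irreducible_not_unit)
    fix a b
    assume "T p = a * b"
    moreover obtain a' b' where "a = T a'" and "b = T b'"
      using surj by metis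
    ultimately have "p = a' * b'"
      by (simp add: T_eq flip: mult)
    then show "a dvd 1 \<or> b dvd 1"
      using \<open>irreducible p\<close> by (auto simp: \<open>a = T a'\<close> \<open>b = T b'\<close> unit dest: irreducibleD)
  qed
qed

text \<open>Precomposition with \<open>inv p\<close> undoes precomposition with \<open>p\<close>.
  Key and value types stay general because this serves twice: for monomials, whose keys are
  variables, and for polynomials, whose keys are monomials.\<close>

lemma bij_map_key:
  fixes p :: "'v \<Rightarrow> 'w"
  assumes "bij p"
  shows "bij (Poly_Mapping.map_key p :: ('w \<Rightarrow>\<^sub>0 'c::zero) \<Rightarrow> _)"
proof (rule o_bij)
  have inj: "inj p" "inj (inv p)"
    using assms by (auto simp: bij_is_inj bij_imp_bij_inv)
  have "inv p \<circ> p = (\<lambda>x. x)" and "p \<circ> inv p = (\<lambda>x. x)"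
    using assms by (simp_all add: fun_eq_iff bij_is_inj bij_is_surj surj_f_inv_f)
  then have "Poly_Mapping.map_key (inv p) (Poly_Mapping.map_key p m) = m"
    and "Poly_Mapping.map_key p (Poly_Mapping.map_key (inv p) m') = m'"
    for m :: "'w \<Rightarrow>\<^sub>0 'c" and m' :: "'v \<Rightarrow>\<^sub>0 'c"
    using inj by (simp_all only: map_key_compose map_key_id)
  then show "Poly_Mapping.map_key (inv p) \<circ> Poly_Mapping.map_key p = (id :: ('w \<Rightarrow>\<^sub>0 'c) \<Rightarrow> _)"
    and "Poly_Mapping.map_key p \<circ> Poly_Mapping.map_key (inv p) = (id :: ('v \<Rightarrow>\<^sub>0 'c) \<Rightarrow> _)"
    by (simp_all add: fun_eq_iff)
qed

text \<open>The coefficient of a product at a monomial sums over its decompositions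
  \<open>l + q\<close>, and an additive bijection \<open>F\<close> matches the decompositions of
  \<open>m\<close> with those of \<open>F m\<close>.\<close>

lemma map_key_mult:
  fixes P Q :: "'m::monoid_add \<Rightarrow>\<^sub>0 'c::semiring_0"
  assumes "bij F" and add: "\<And>l q. F (l + q) = F l + F q"
  shows "Poly_Mapping.map_key F (P * Q) = Poly_Mapping.map_key F P * Poly_Mapping.map_key F Q"
proof (rule poly_mapping_eqI)
  fix m
  have F_eq: "F a = F b \<longleftrightarrow> a = b" for a b
    using \<open>bij F\<close> by (simp add: bij_is_inj inj_eq)
  have lookup_F: "Poly_Mapping.lookup (Poly_Mapping.map_key F R) l = Poly_Mapping.lookup R (F l)"
    for R :: "'m \<Rightarrow>\<^sub>0 'c" and l
    using \<open>bij F\<close> by (simp add: map_key.rep_eq bij_is_inj)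
  \<comment> \<open>The two summation indices are substituted one at a time, \<open>q\<close> first
    with \<open>l\<close> fixed; additivity and injectivity turn \<open>F m = F l + F q\<close> into
    \<open>m = l + q\<close>.\<close>
  have inner: "(\<Sum>q. Poly_Mapping.lookup Q q when F m = F l + q) =
      (\<Sum>q. Poly_Mapping.lookup Q (F q) when m = l + q)" for l
    by (rule Sum_any.reindex_cong[OF \<open>bij F\<close>]) (simp add: fun_eq_iff F_eq flip: add)
  have "(\<Sum>l. Poly_Mapping.lookup P l * (\<Sum>q. Poly_Mapping.lookup Q q when F m = l + q)) =
      (\<Sum>l. Poly_Mapping.lookup P (F l) * (\<Sum>q. Poly_Mapping.lookup Q (F q) when m = l + q))"
    by (rule Sum_any.reindex_cong[OF \<open>bij F\<close>]) (simp add: fun_eq_iff inner)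
  then show "Poly_Mapping.lookup (Poly_Mapping.map_key F (P * Q)) m =
      Poly_Mapping.lookup (Poly_Mapping.map_key F P * Poly_Mapping.map_key F Q) m"
    by (simp add: lookup_F times_poly_mapping.rep_eq prod_fun_def)
qed

section \<open>Renaming variables along a bijection\<close>

text \<open>
  \<open>mpoly_rename p\<close> replaces the variable \<open>v\<close> by \<open>p v\<close>, but only for injective \<open>p\<close>, since
  \<^const>\<open>Poly_Mapping.map_key\<close> is unspecified otherwise.
\<close>

definition mpoly_rename :: "('v \<Rightarrow> 'v) \<Rightarrow> ('v, 'c::zero) mpolynomial \<Rightarrow> ('v, 'c) mpolynomial" where
  "mpoly_rename p P = Poly_Mapping.map_key (Poly_Mapping.map_key p) P"

context
  fixes p :: "'v \<Rightarrow> 'v"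
  assumes bij: "bij p"
begin

lemma bij_mpoly_rename: "bij (mpoly_rename p)"
  unfolding mpoly_rename_def[abs_def] by (intro bij_map_key bij)

text \<open>Two nested precompositions cancel each other's reversal of direction: the monomial
  \<open>map_key p m\<close> of \<open>P\<close> becomes \<open>m\<close>, so the exponent of
  \<open>v\<close> moves forward to \<open>p v\<close>.\<close>

lemma lookup_mpoly_rename:
  "Poly_Mapping.lookup (mpoly_rename p P) m = Poly_Mapping.lookup P (Poly_Mapping.map_key p m)"
  by (simp add: mpoly_rename_def map_key.rep_eq bij_map_key[OF bij, THEN bij_is_inj])

lemma keys_mpoly_rename:
  "Poly_Mapping.keys (mpoly_rename p P) = Poly_Mapping.map_key p -` Poly_Mapping.keys P"
  by (simp add: mpoly_rename_def keys_map_key bij_map_key[OF bij, THEN bij_is_inj])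

lemma image_keys_map_key:
  "p ` Poly_Mapping.keys (Poly_Mapping.map_key p m) = Poly_Mapping.keys m"
  using bij by (simp add: keys_map_key bij_is_inj bij_is_surj surj_image_vimage_eq)

lemma mpoly_vars_rename: "mpoly_vars (mpoly_rename p P) = p ` mpoly_vars P"
proof -
  have "mpoly_vars (mpoly_rename p P) =
      (\<Union>m\<in>Poly_Mapping.map_key p -` Poly_Mapping.keys P.
        p ` Poly_Mapping.keys (Poly_Mapping.map_key p m))"
    by (simp add: mpoly_vars_def keys_mpoly_rename image_keys_map_key)
  also have "\<dots> = p ` (\<Union>m\<in>Poly_Mapping.map_key p ` (Poly_Mapping.map_key p -` Poly_Mapping.keys P).
      Poly_Mapping.keys m)"
    by blast
  also have "\<dots> = p ` mpoly_vars P"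
    by (simp only: surj_image_vimage_eq bij_map_key[OF bij, THEN bij_is_surj] mpoly_vars_def)
  finally show ?thesis .
qed

text \<open>The variable \<open>v\<close> becomes \<open>p v\<close> and so receives the value
  \<open>x (p v)\<close>. The products are reindexed along \<open>p\<close>, the sum over monomials
  along \<open>map_key p\<close>.\<close>

lemma mpoly_eval_rename: "mpoly_eval h x (mpoly_rename p P) = mpoly_eval h (x \<circ> p) P"
proof -
  let ?F = "Poly_Mapping.map_key p :: ('v \<Rightarrow>\<^sub>0 nat) \<Rightarrow> ('v \<Rightarrow>\<^sub>0 nat)"
  have inj: "inj_on p S" for S
    by (rule inj_on_subset[OF bij_is_inj[OF bij] subset_UNIV])
  have prod: "(\<Prod>v\<in>Poly_Mapping.keys m. x v ^ Poly_Mapping.lookup m v) =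
      (\<Prod>v\<in>Poly_Mapping.keys (?F m). (x \<circ> p) v ^ Poly_Mapping.lookup (?F m) v)" for m
  proof -
    have "(\<Prod>v\<in>p ` Poly_Mapping.keys (?F m). x v ^ Poly_Mapping.lookup m v) =
        (\<Prod>v\<in>Poly_Mapping.keys (?F m). (x \<circ> p) v ^ Poly_Mapping.lookup (?F m) v)"
      by (simp only: prod.reindex[OF inj] map_key.rep_eq[OF inj] comp_def)
    then show ?thesis
      by (simp only: image_keys_map_key)
  qed
  have F: "bij_betw ?F (?F -` Poly_Mapping.keys P) (Poly_Mapping.keys P)"
    using bij_map_key[OF bij, where ?'c = nat]
    by (metis bij_betw_def inj_on_subset subset_UNIV surj_image_vimage_eq)
  show ?thesis
    unfolding mpoly_eval_def keys_mpoly_rename sum.reindex_bij_betw[OF F, symmetric]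
    by (simp only: lookup_mpoly_rename prod)
qed

lemma irreducible_mpoly_rename:
  fixes P :: "('v, 'c::comm_semiring_1) mpolynomial"
  assumes "irreducible P"
  shows "irreducible (mpoly_rename p P)"
proof (rule irreducible_bij_image[OF bij_mpoly_rename _ _ _ assms])
  let ?F = "Poly_Mapping.map_key p :: ('v \<Rightarrow>\<^sub>0 nat) \<Rightarrow> ('v \<Rightarrow>\<^sub>0 nat)"
  have F: "bij ?F"
    by (rule bij_map_key[OF bij])
  have F_zero: "?F 0 = 0"
    using bij by (simp add: map_key_zero bij_is_inj)
  show "mpoly_rename p (0 :: ('v, 'c) mpolynomial) = 0"
    by (rule poly_mapping_eqI) (simp add: lookup_mpoly_rename)
  \<comment> \<open>The only nonzero coefficient of the polynomial 1 sits at the zero monomial, so 1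
    is fixed once that monomial is its own sole preimage under \<open>?F\<close>.\<close>
  have "?F m = 0 \<longleftrightarrow> m = 0" for m
    using F F_zero by (metis bij_is_inj injD)
  then show "mpoly_rename p (1 :: ('v, 'c) mpolynomial) = 1"
    by (intro poly_mapping_eqI) (simp add: lookup_mpoly_rename one_poly_mapping.rep_eq)
  show "mpoly_rename p (a * b) = mpoly_rename p a * mpoly_rename p b"
    for a b :: "('v, 'c) mpolynomial"
    unfolding mpoly_rename_def using F bij
    by (intro map_key_mult) (simp_all add: map_key_plus bij_is_inj)
qed

end

lemma mpoly_eval_cong:
  assumes "\<And>v. v \<in> mpoly_vars P \<Longrightarrow> x v = y v"
  shows "mpoly_eval h x P = mpoly_eval h y P"
proof -
  have "(\<Prod>v\<in>Poly_Mapping.keys m. x v ^ Poly_Mapping.lookup m v) =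
      (\<Prod>v\<in>Poly_Mapping.keys m. y v ^ Poly_Mapping.lookup m v)" if "m \<in> Poly_Mapping.keys P" for m
  proof (rule prod.cong[OF refl])
    fix v
    assume "v \<in> Poly_Mapping.keys m"
    with that have "v \<in> mpoly_vars P"
      by (auto simp: mpoly_vars_def)
    then show "x v ^ Poly_Mapping.lookup m v = y v ^ Poly_Mapping.lookup m v"
      by (simp add: assms)
  qed
  then show ?thesis
    by (simp add: mpoly_eval_def)
qed

section \<open>Permuting tensor indices\<close>

lemma bij_map: "bij p \<Longrightarrow> bij (map p)"
  by (rule o_bij[of "map (inv p)"])
    (auto simp: fun_eq_iff bij_is_inj bij_is_surj surj_iff[THEN iffD1])

lemma map_permutes_tensor_indices:
  assumes "p permutes {1..n}"
  shows "map p ` tensor_indices k n = tensor_indices k n"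
proof -
  \<comment> \<open>One inclusion, stated for every permutation, suffices: its instance for
    \<open>inv p\<close> yields the reverse one.\<close>
  have sub: "map q ` tensor_indices k n \<subseteq> tensor_indices k n" if "q permutes {1..n}" for q
    using that by (auto simp: tensor_indices_def permutes_in_image subset_iff simp del: atLeastAtMost_iff)
  have "tensor_indices k n = map p ` map (inv p) ` tensor_indices k n"
    using assms by (simp add: image_image permutes_inv_o(1))
  also have "\<dots> \<subseteq> map p ` tensor_indices k n"
    using sub[OF permutes_inv[OF assms]] by (rule image_mono)
  finally show ?thesis
    using sub[OF assms] by blast
qed

lemma unit_tensor_map: "inj p \<Longrightarrow> unit_tensor (map p is) = unit_tensor is"
  by (auto simp: unit_tensor_def inj_eq)

text \<open>Since \<open>map p\<close> permutes the index lists of length \<open>k - 1\<close>, the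
  right-hand sum can be reindexed by \<open>map p js\<close>; together with the leading index
  \<open>p i\<close> this is \<open>map p (i # js)\<close>.\<close>

lemma tensor_apply_permute:
  assumes p: "p permutes {1..n}"
  shows "tensor_apply k n (A \<circ> map p) (x \<circ> p) i = tensor_apply k n A x (p i)"
proof -
  have "inj_on (map p) S" for S
    using bij_map[OF permutes_bij[OF p]] bij_is_inj inj_on_subset by blast
  then show ?thesis
    unfolding tensor_apply_def
    by (subst (2) map_permutes_tensor_indices[OF p, symmetric]) (simp add: sum.reindex)
qed

text \<open>Precomposition with \<open>q\<close> carries a nonzero solution for \<open>B\<close> to
  one for \<open>B \<circ> map q\<close>; the converse is the case of \<open>inv p\<close>.\<close>

lemma singular_tensor_permute:
  assumes p: "p permutes {1..n}"
  shows "(\<exists>x. (\<exists>i\<in>{1..n}. x i \<noteq> 0) \<and> (\<forall>i\<in>{1..n}. tensor_apply k n (A \<circ> map p) x i = 0)) \<longleftrightarrow>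
    (\<exists>x. (\<exists>i\<in>{1..n}. x i \<noteq> 0) \<and> (\<forall>i\<in>{1..n}. tensor_apply k n A x i = 0))"
    (is "?sing (A \<circ> map p) \<longleftrightarrow> ?sing A")
proof -
  have sing: "?sing (B \<circ> map q)" if q: "q permutes {1..n}" and "?sing B" for q B
  proof -
    from \<open>?sing B\<close> obtain x i where i: "i \<in> {1..n}" "x i \<noteq> 0"
      and x: "\<And>j. j \<in> {1..n} \<Longrightarrow> tensor_apply k n B x j = 0"
      by blast
    have "\<exists>j\<in>{1..n}. (x \<circ> q) j \<noteq> 0"
      using i permutes_image[OF q] by (metis comp_apply imageE)
    moreover have "\<forall>j\<in>{1..n}. tensor_apply k n (B \<circ> map q) (x \<circ> q) j = 0"
    proof
      fix j
      assume "j \<in> {1..n}"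
      then have "q j \<in> {1..n}"
        using permutes_in_image[OF q] by blast
      then show "tensor_apply k n (B \<circ> map q) (x \<circ> q) j = 0"
        by (simp only: tensor_apply_permute[OF q] x)
    qed
    ultimately show ?thesis
      by blast
  qed
  have inv: "A \<circ> map p \<circ> map (inv p) = A"
    using p by (simp add: fun_eq_iff permutes_inv_o(1))
  show ?thesis
  proof
    assume "?sing (A \<circ> map p)"
    from sing[OF permutes_inv[OF p] this] show "?sing A"
      by (simp only: inv)
  qed (rule sing[OF p])
qed

section \<open>Invariance of the hyperdeterminant and the characteristic polynomial\<close>

text \<open>Evaluating the renamed polynomial at \<open>A\<close> is evaluating \<open>D\<close> at
  \<open>A \<circ> map p\<close>, which is singular exactly when \<open>A\<close> is and equals the
  unit tensor when \<open>A\<close> does.\<close>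

lemma is_hyperdet_poly_rename:
  assumes p: "p permutes {1..n}" and D: "is_hyperdet_poly k n D"
  shows "is_hyperdet_poly k n (mpoly_rename (map p) D)"
proof -
  have bij: "bij (map p)"
    by (rule bij_map[OF permutes_bij[OF p]])
  have "unit_tensor \<circ> map p = (unit_tensor :: complex tensor)"
    using permutes_inj[OF p] by (simp add: fun_eq_iff unit_tensor_map)
  moreover have "map p ` mpoly_vars D \<subseteq> tensor_indices k n"
    using D map_permutes_tensor_indices[OF p] by (metis image_mono is_hyperdet_poly_def)
  ultimately show ?thesis
    using D singular_tensor_permute[OF p, of k]
    by (simp add: is_hyperdet_poly_def mpoly_vars_rename[OF bij] mpoly_eval_rename[OF bij]
        irreducible_mpoly_rename[OF bij])
qed

lemma hyperdet_poly_rename: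
  assumes "p permutes {1..n}"
  shows "mpoly_rename (map p) (hyperdet_poly k n) = hyperdet_poly k n"
proof (cases "\<exists>!D. is_hyperdet_poly k n D")
  case True
  then have "is_hyperdet_poly k n (hyperdet_poly k n)"
    by (simp add: hyperdet_poly_def theI')
  then show ?thesis
    using True is_hyperdet_poly_rename[OF assms] by blast
next
  case False
  have "bij (map p)"
    by (rule bij_map[OF permutes_bij[OF assms]])
  with False show ?thesis
    by (auto simp: hyperdet_poly_def lookup_mpoly_rename intro: poly_mapping_eqI)
qed

lemma mpoly_vars_hyperdet_poly: "mpoly_vars (hyperdet_poly k n) \<subseteq> tensor_indices k n"
proof (cases "\<exists>!D. is_hyperdet_poly k n D")
  case True
  then have "is_hyperdet_poly k n (hyperdet_poly k n)"
    by (simp add: hyperdet_poly_def theI')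
  then show ?thesis
    by (simp add: is_hyperdet_poly_def)
next
  case False
  then show ?thesis
    by (auto simp: hyperdet_poly_def mpoly_vars_def)
qed

text \<open>Only entries at variables of \<open>hyperdet_poly k n\<close> enter, and these lie in
  \<open>tensor_indices k n\<close>. This absorbs the arbitrary values of vertex orderings outside
  \<open>{1..n}\<close>.\<close>

lemma tensor_charpoly_cong:
  assumes "\<And>is. is \<in> tensor_indices k n \<Longrightarrow> A is = B is"
  shows "tensor_charpoly k n A = tensor_charpoly k n B"
  unfolding tensor_charpoly_def
proof (rule mpoly_eval_cong)
  fix "is"
  assume "is \<in> mpoly_vars (hyperdet_poly k n)"
  then have "is \<in> tensor_indices k n"
    using mpoly_vars_hyperdet_poly by blast
  then show "[:0, 1:] * unit_tensor is - [:A is:] = [:0, 1:] * unit_tensor is - [:B is:]"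
    by (simp add: assms)
qed

lemma tensor_charpoly_permute:
  assumes p: "p permutes {1..n}"
  shows "tensor_charpoly k n (A \<circ> map p) = tensor_charpoly k n A"
proof -
  let ?entries = "\<lambda>A is. [:0, 1:] * unit_tensor is - [:A is:] :: complex poly"
  \<comment> \<open>The diagonal part is unchanged by \<open>map p\<close>, so the permutation
    passes from \<open>A\<close> to the whole matrix of entries and from there to the variables of
    the polynomial.\<close>
  have "?entries (A \<circ> map p) = ?entries A \<circ> map p"
    using permutes_inj[OF p] by (simp add: fun_eq_iff unit_tensor_map)
  then have "tensor_charpoly k n (A \<circ> map p) =
      mpoly_eval (\<lambda>c. [:c:]) (?entries A) (mpoly_rename (map p) (hyperdet_poly k n))"
    by (simp only: tensor_charpoly_def mpoly_eval_rename[OF bij_map[OF permutes_bij[OF p]]])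
  then show ?thesis
    by (simp add: tensor_charpoly_def hyperdet_poly_rename[OF p])
qed

section \<open>Spectra of isomorphic hypergraphs\<close>

text \<open>The index permutation "\<open>f\<close>, then \<open>\<phi>\<close>, then the inverse of
  \<open>g\<close>" carries one adjacency tensor to the other on all valid index lists.\<close>

lemma hypergraph_spectrum_isomorphic:
  assumes iso: "hypergraph_isomorphic V E W F"
    and f: "vertex_ordering V f" and g: "vertex_ordering W g"
  shows "hypergraph_spectrum k V E f = hypergraph_spectrum k W F g"
proof -
  obtain \<phi> where \<phi>: "bij_betw \<phi> V W" and edges: "\<And>e. e \<subseteq> V \<Longrightarrow> e \<in> E \<longleftrightarrow> \<phi> ` e \<in> F"
    using iso by (auto simp: hypergraph_isomorphic_def)
  let ?n = "card V"
  have card: "card W = ?n"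
    using bij_betw_same_card[OF \<phi>] by simp
  \<comment> \<open>Extending by the identity makes \<open>p\<close> a bijection on all of
    \<open>nat\<close>, so that \<open>map p\<close> is a bijection on all index lists, as renaming
    requires.\<close>
  define p where "p i = (if i \<in> {1..?n} then inv_into {1..?n} g (\<phi> (f i)) else i)" for i
  have bij_f: "bij_betw f {1..?n} V" and bij_g: "bij_betw g {1..?n} W"
    using f g by (simp_all add: vertex_ordering_def card)
  have "bij_betw (inv_into {1..?n} g \<circ> (\<phi> \<circ> f)) {1..?n} {1..?n}"
    using bij_betw_trans[OF bij_betw_trans[OF bij_f \<phi>] bij_betw_inv_into[OF bij_g]] .
  then have "bij_betw p {1..?n} {1..?n}"
    by (rule bij_betw_cong[THEN iffD1, rotated]) (simp add: p_def)
  then have p: "p permutes {1..?n}"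
    by (rule bij_imp_permutes) (auto simp: p_def)
  have gp: "g (p i) = \<phi> (f i)" if "i \<in> {1..?n}" for i
  proof -
    have "\<phi> (f i) \<in> W"
      using that bij_betwE[OF bij_f] bij_betwE[OF \<phi>] by blast
    then have "g (inv_into {1..?n} g (\<phi> (f i))) = \<phi> (f i)"
      by (rule bij_betw_inv_into_right[OF bij_g])
    with that show ?thesis
      by (simp add: p_def)
  qed
  have "adjacency_tensor k E f is = (adjacency_tensor k F g \<circ> map p) is"
    if "is \<in> tensor_indices k ?n" for "is"
  proof -
    have "is": "set is \<subseteq> {1..?n}"
      using that by (simp add: tensor_indices_def)
    then have "g ` p ` set is = \<phi> ` f ` set is"
      using gp by (force simp: image_image intro!: image_cong)
    \<comment> \<open>\<open>edges\<close> compares edges only for subsets of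
      \<open>V\<close>.\<close>
    moreover have "f ` set is \<subseteq> V"
      using "is" bij_f by (auto simp: bij_betw_def)
    ultimately show ?thesis
      by (simp add: adjacency_tensor_def edges)
  qed
  then have "tensor_charpoly k ?n (adjacency_tensor k E f) =
      tensor_charpoly k ?n (adjacency_tensor k F g \<circ> map p)"
    by (rule tensor_charpoly_cong)
  then show ?thesis
    by (simp add: hypergraph_spectrum_def tensor_spectrum_def card tensor_charpoly_permute[OF p])
qed

theorem theorem2p2:
  fixes k :: nat
  assumes "k \<ge> 2"
  shows
    "(\<forall>(V :: 'a set) E f g.
        uniform_hypergraph k V E \<and> vertex_ordering V f \<and> vertex_ordering V g \<longrightarrow>
        hypergraph_spectrum k V E f = hypergraph_spectrum k V E g)
   \<and> (\<forall>(V :: 'b set) E (W :: 'c set) F f g.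
        uniform_hypergraph k V E \<and> uniform_hypergraph k W F \<and>
        hypergraph_isomorphic V E W F \<and> vertex_ordering V f \<and> vertex_ordering W g \<longrightarrow>
        hypergraph_spectrum k V E f = hypergraph_spectrum k W F g)"
proof -
  \<comment> \<open>Two orderings of one hypergraph are compared through the identity isomorphism,
    so both claims are instances of the same lemma.\<close>
  have "hypergraph_isomorphic V E V E" for V :: "'a set" and E
    unfolding hypergraph_isomorphic_def by (rule exI[of _ id]) simp
  then show ?thesis
    by (blast intro: hypergraph_spectrum_isomorphic)
qed

end
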